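(* Let $p\in[1,+\infty[$ and let $\nu,\beta\in]0,+\infty[$ with $\nu\ge\beta$. Let $\mathbf X$ be the Hunt process on $E$ with semigroup kernel $p_t(x,y)$ described in the context, and suppose that the upper and lower heat kernel estimates described in the context hold. Let $\mu$ be a positive Borel measure on $E$. Then the following are equivalent: (1) $\mu\in K_{\nu,\beta}^{\,p}$. (2) For any $\alpha>0$, $\lim_{r\to0}\sup_{x\in E}\int_{B_r(x)}r_\alpha(x,y)^p\mu(dy)=0$. (3) For some $\alpha>0$, $\lim_{r\to0}\sup_{x\in E}\int_{B_r(x)}r_\alpha(x,y)^p\mu(dy)=0$. (4) For any $t>0$, $\lim_{r\to0}\sup_{x\in E}\int_{B_r(x)}\big(\int_0^tp_s(x,y)\,ds\big)^p\mu(dy)=0$. (5) For some $t>0$, $\lim_{r\to0}\sup_{x\in E}\int_{B_r(x)}\big(\int_0^tp_s(x,y)\,ds\big)^p\mu(dy)=0$. Moreover, the following are equivalent: (1') $\mu\in D_{\nu,\beta}^{\,p}$. (2') For any $\alpha>0$, $\sup_{x\in E}\int_{B_r(x)}r_\alpha(x,y)^p\mu(dy)<+\infty$ for some $r>0$. (3') For some $\alpha>0$, $\sup_{x\in E}\int_{B_r(x)}r_\alpha(x,y)^p\mu(dy)<+\infty$ for some $r>0$. (4') For any $t>0$, $\sup_{x\in E}\int_{B_r(x)}\big(\int_0^tp_s(x,y)\,ds\big)^p\mu(dy)<+\infty$ for some $r>0$. (5') For some $t>0$, $\sup_{x\in E}\int_{B_r(x)}\big(\int_0^tp_s(x,y)\,ds\big)^p\mu(dy)<+\infty$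 for some $r>0$.
   Context: Notation: $]a,b[$ denotes an open interval, $a\lor b=\max\{a,b\}$; "increasing" and "decreasing" are in the wide (non-strict) sense. Setting. $(E,d)$ is a locally compact separable metric space, $\mathfrak m$ is a positive Radon measure on $E$ with full support, $B_r(x)=\{y\in E: d(x,y)<r\}$. $(\mathscr E,\mathscr F)$ is a symmetric regular Dirichlet form on $L^2(E;\mathfrak m)$, and $\mathbf X=(\Omega,X_t,\zeta,\mathbf P_x)$ is an associated Hunt process. It is assumed that there is a jointly measurable nonnegative function $p_t(x,y)$, $(t,x,y)\in]0,+\infty[\times E\times E$ (semigroup kernel, or heat kernel) with $\mathbf E_x[u(X_t)]=\int_E p_t(x,y)u(y)\,\mathfrak m(dy)$ for all $x\in E$, $t>0$ and bounded Borel $u$; moreover $p_{t+s}(x,y)=\int_E p_s(x,z)p_t(z,y)\,\mathfrak m(dz)$ for all $x,y\in E$, $s,t>0$, and $\int_E p_t(x,y)\,\mathfrak m(dy)\le 1$. For $\alpha>0$ the $\alpha$-order resolvent kernel is $r_\alpha(x,y)=\int_0^\infty e^{-\alpha t}p_t(x,y)\,dt$. Assumption (upper and lower heat kernel estimates). Fix $\nu,\beta\in]0,+\infty[$, $t_0\in]0,+\infty]$, and an increasing positive function $V$ on $]0,+\infty[$. There are positive decreasing functions $\Phi_1,\Phi_2$ on $[0,+\infty[$ (possibly depending on $t_0$ if $t_0<+\infty$) with $\int_1^\infty \frac{(V(t)\lor t^\nu)\Phi_2(t)}{t}\,dt<+\infty$ and, for all $x,y\in E$, $t\in]0,t_0[$,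 $$\frac{1}{t^{\nu/\beta}}\Phi_1\Big(\frac{d(x,y)}{t^{1/\beta}}\Big)\le p_t(x,y)\le \frac{1}{t^{\nu/\beta}}\Phi_2\Big(\frac{d(x,y)}{t^{1/\beta}}\Big).$$ Classes of measures (for $\nu\ge\beta$). Put $G(r)=r^{\beta-\nu}$ for $r\in]0,+\infty[$ if $\nu>\beta$, $G(r)=\log(r^{-1})$ for $r\in]0,1[$ if $\nu=\beta$, $G(0)=+\infty$, and $G(x,y)=G(d(x,y))$. - $D_{\nu,\beta}^{\,p}$ is the set of positive Borel measures $\mu$ on $E$ with $\sup_{x\in E}\int_{d(x,y)<r}G(x,y)^p\mu(dy)<+\infty$ for some $r>0$ ($r<1$ if $\nu=\beta$). - $K_{\nu,\beta}^{\,p}$ is the set of positive Borel measures $\mu$ on $E$ with $\lim_{r\to0}\sup_{x\in E}\int_{d(x,y)<r}G(x,y)^p\mu(dy)=0$. *)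

theory Defs
  imports "HOL-Probability.Probability"
begin

section \<open>The state space\<close>

text \<open>
  The state space \<open>E\<close> is a whole type of class
  \<open>{metric_space, second_countable_topology}\<close>; for metric spaces, second countable means separable.
  Local compactness is an explicit hypothesis.
\<close>

text \<open>
  On a locally compact separable metric space every Borel measure that is finite on compact sets
  is regular, so finiteness on compact sets is all that ``Radon'' requires.
\<close>

definition radon_measure :: "'a::topological_space measure \<Rightarrow> bool" where
  "radon_measure m \<longleftrightarrow> sets m = sets borel \<and> (\<forall>K. compact K \<longrightarrow> emeasure m K < \<infinity>)"

definition full_support :: "'a::topological_space measure \<Rightarrow> bool" where
  "full_support m \<longleftrightarrow> (\<forall>U. open U \<and> U \<noteq> {} \<longrightarrow> emeasure m U > 0)"


section \<open>Dirichlet forms\<close>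

text \<open>
  Elements of $L^2(E;m)$ are represented by Borel functions, so sets of functions and
  forms have to be invariant under modification on null sets.
\<close>

definition L2 :: "'a measure \<Rightarrow> ('a \<Rightarrow> real) set" where
  "L2 m = {u \<in> borel_measurable m. integrable m (\<lambda>x. (u x)\<^sup>2)}"

definition L2_inner :: "'a measure \<Rightarrow> ('a \<Rightarrow> real) \<Rightarrow> ('a \<Rightarrow> real) \<Rightarrow> real" where
  "L2_inner m u v = (\<integral>x. u x * v x \<partial>m)"

definition L2_norm :: "'a measure \<Rightarrow> ('a \<Rightarrow> real) \<Rightarrow> real" where
  "L2_norm m u = sqrt (L2_inner m u u)"

text \<open>The norm given by $\mathcal{E}_1(u,u) = \mathcal{E}(u,u) + (u,u)_{L^2}$.\<close>

definition form_norm ::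
  "'a measure \<Rightarrow> (('a \<Rightarrow> real) \<Rightarrow> ('a \<Rightarrow> real) \<Rightarrow> real) \<Rightarrow> ('a \<Rightarrow> real) \<Rightarrow> real" where
  "form_norm m \<E> u = sqrt (\<E> u u + L2_inner m u u)"

locale dirichlet_form =
  fixes m :: "'a measure"
    and \<F> :: "('a \<Rightarrow> real) set"
    and \<E> :: "('a \<Rightarrow> real) \<Rightarrow> ('a \<Rightarrow> real) \<Rightarrow> real"
  assumes domain_L2: "\<F> \<subseteq> L2 m"
    and domain_AE: "\<And>u v. u \<in> \<F> \<Longrightarrow> v \<in> borel_measurable m \<Longrightarrow> (AE x in m. u x = v x) \<Longrightarrow> v \<in> \<F>"
    and domain_zero: "(\<lambda>x. 0) \<in> \<F>"
    and domain_add: "\<And>u v. u \<in> \<F> \<Longrightarrow> v \<in> \<F> \<Longrightarrow> (\<lambda>x. u x + v x) \<in> \<F>"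
    and domain_scale: "\<And>c u. u \<in> \<F> \<Longrightarrow> (\<lambda>x. c * u x) \<in> \<F>"
    and domain_dense: "\<And>u e. u \<in> L2 m \<Longrightarrow> e > 0 \<Longrightarrow> \<exists>v\<in>\<F>. L2_norm m (\<lambda>x. u x - v x) < e"
    and form_AE: "\<And>u v w. u \<in> \<F> \<Longrightarrow> v \<in> \<F> \<Longrightarrow> w \<in> \<F> \<Longrightarrow> (AE x in m. u x = v x) \<Longrightarrow> \<E> u w = \<E> v w"
    and form_add: "\<And>u v w. u \<in> \<F> \<Longrightarrow> v \<in> \<F> \<Longrightarrow> w \<in> \<F> \<Longrightarrow> \<E> (\<lambda>x. u x + v x) w = \<E> u w + \<E> v w"
    and form_scale: "\<And>c u v. u \<in> \<F> \<Longrightarrow> v \<in> \<F> \<Longrightarrow> \<E> (\<lambda>x. c * u x) v = c * \<E> u v"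
    and form_sym: "\<And>u v. u \<in> \<F> \<Longrightarrow> v \<in> \<F> \<Longrightarrow> \<E> u v = \<E> v u"
    and form_nonneg: "\<And>u. u \<in> \<F> \<Longrightarrow> \<E> u u \<ge> 0"
    and form_closed: "\<And>u :: nat \<Rightarrow> 'a \<Rightarrow> real. range u \<subseteq> \<F> \<Longrightarrow>
          (\<forall>e>0. \<exists>N. \<forall>i\<ge>N. \<forall>j\<ge>N. form_norm m \<E> (\<lambda>x. u i x - u j x) < e) \<Longrightarrow>
          \<exists>v\<in>\<F>. (\<lambda>n. form_norm m \<E> (\<lambda>x. u n x - v x)) \<longlonglongrightarrow> 0"
    and form_markovian: "\<And>u. u \<in> \<F> \<Longrightarrow>
          (\<lambda>x. min (max (u x) 0) 1) \<in> \<F> \<and>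
          \<E> (\<lambda>x. min (max (u x) 0) 1) (\<lambda>x. min (max (u x) 0) 1) \<le> \<E> u u"

definition cont_compact_support :: "('a::topological_space \<Rightarrow> real) set" where
  "cont_compact_support = {f. continuous_on UNIV f \<and> compact (closure {x. f x \<noteq> 0})}"

locale regular_dirichlet_form = dirichlet_form m \<F> \<E>
  for m :: "'a::topological_space measure" and \<F> \<E> +
  assumes regular_form: "\<And>u e. u \<in> \<F> \<Longrightarrow> e > 0 \<Longrightarrow>
          \<exists>v \<in> \<F> \<inter> cont_compact_support. form_norm m \<E> (\<lambda>x. u x - v x) < e"
    and regular_unif: "\<And>f e. f \<in> cont_compact_support \<Longrightarrow> e > 0 \<Longrightarrow>
          \<exists>v \<in> \<F> \<inter> cont_compact_support. \<forall>x. \<bar>f x - v x\<bar> < e"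

text \<open>
  \<open>T\<close> is the strongly continuous symmetric contraction semigroup on $L^2(E;m)$ that corresponds
  to the form, i.e. the form is
  $\mathcal{E}(u,v) = \lim_{t\downarrow 0} \frac1t (u - T_t u, v)$ with domain
  $\{u \in L^2 : \lim_{t\downarrow 0} \frac1t (u - T_t u, u) < \infty\}$.
\<close>

locale L2_semigroup_of_form =
  fixes m :: "'a measure"
    and \<F> :: "('a \<Rightarrow> real) set"
    and \<E> :: "('a \<Rightarrow> real) \<Rightarrow> ('a \<Rightarrow> real) \<Rightarrow> real"
    and T :: "real \<Rightarrow> ('a \<Rightarrow> real) \<Rightarrow> ('a \<Rightarrow> real)"
  assumes semigroup_L2: "\<And>t u. t > 0 \<Longrightarrow> u \<in> L2 m \<Longrightarrow> T t u \<in> L2 m"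
    and semigroup_AE: "\<And>t u v. t > 0 \<Longrightarrow> u \<in> L2 m \<Longrightarrow> v \<in> L2 m \<Longrightarrow> (AE x in m. u x = v x) \<Longrightarrow>
          AE x in m. T t u x = T t v x"
    and semigroup_add: "\<And>t u v. t > 0 \<Longrightarrow> u \<in> L2 m \<Longrightarrow> v \<in> L2 m \<Longrightarrow>
          AE x in m. T t (\<lambda>y. u y + v y) x = T t u x + T t v x"
    and semigroup_scale: "\<And>t c u. t > 0 \<Longrightarrow> u \<in> L2 m \<Longrightarrow>
          AE x in m. T t (\<lambda>y. c * u y) x = c * T t u x"
    and semigroup_mult: "\<And>s t u. s > 0 \<Longrightarrow> t > 0 \<Longrightarrow> u \<in> L2 m \<Longrightarrow>
          AE x in m. T (s + t) u x = T s (T t u) x"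
    and semigroup_sym: "\<And>t u v. t > 0 \<Longrightarrow> u \<in> L2 m \<Longrightarrow> v \<in> L2 m \<Longrightarrow>
          L2_inner m (T t u) v = L2_inner m u (T t v)"
    and semigroup_contraction: "\<And>t u. t > 0 \<Longrightarrow> u \<in> L2 m \<Longrightarrow> L2_norm m (T t u) \<le> L2_norm m u"
    and semigroup_continuous: "\<And>u. u \<in> L2 m \<Longrightarrow>
          ((\<lambda>t. L2_norm m (\<lambda>x. T t u x - u x)) \<longlongrightarrow> 0) (at_right 0)"
    and form_domain: "\<F> = {u \<in> L2 m. \<exists>l::real.
          ((\<lambda>t. L2_inner m (\<lambda>x. u x - T t u x) u / t) \<longlongrightarrow> l) (at_right 0)}"
    and form_limit: "\<And>u v. u \<in> \<F> \<Longrightarrow> v \<in> \<F> \<Longrightarrow>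
          ((\<lambda>t. L2_inner m (\<lambda>x. u x - T t u x) v / t) \<longlongrightarrow> \<E> u v) (at_right 0)"


section \<open>Hunt processes\<close>

text \<open>
  The state space with cemetery \<open>None\<close> adjoined: as the point at infinity if \<open>E\<close> is not compact,
  and as an isolated point if \<open>E\<close> is compact. Both are instances of the library's
  \<open>Alexandroff_compactification\<close>.
\<close>

definition cemetery_topology :: "'a::topological_space option topology" where
  "cemetery_topology = Alexandroff_compactification euclidean"

definition cemetery_borel :: "'a::topological_space option measure" where
  "cemetery_borel = sigma UNIV {U. openin cemetery_topology U}"

text \<open>
  The time set is $[0,\infty]$, i.e. the type \<open>ennreal\<close>; stopping times may thus be infinite.
\<close>

definition lifetime :: "(ennreal \<Rightarrow> 'w \<Rightarrow> 'a option) \<Rightarrow> 'w \<Rightarrow> ennreal" where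
  "lifetime X \<omega> = Inf {t. X t \<omega> = None}"

definition admissible_filtration ::
  "'w measure \<Rightarrow> (ennreal \<Rightarrow> 'w \<Rightarrow> 'a::topological_space option) \<Rightarrow> (ennreal \<Rightarrow> 'w measure) \<Rightarrow> bool" where
  "admissible_filtration M X \<G> \<longleftrightarrow>
     filtration (space M) \<G> \<and>
     (\<forall>t. subalgebra M (\<G> t) \<and> X t \<in> measurable (\<G> t) cemetery_borel) \<and>
     (\<forall>t<\<infinity>. sets (\<G> t) = (\<Inter>s\<in>{t<..}. sets (\<G> s)))"

text \<open>
  $P_x(X_{\sigma+s} \in B \mid \mathcal{G}_\sigma) = P_{X_\sigma}(X_s \in B)$ almost surely. Starting
  points range over the whole space including the cemetery; general initial distributions are
  mixtures of these.
\<close>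

definition strong_markov ::
  "'w measure \<Rightarrow> (ennreal \<Rightarrow> 'w \<Rightarrow> 'a::topological_space option) \<Rightarrow> ('a option \<Rightarrow> 'w measure) \<Rightarrow>
   (ennreal \<Rightarrow> 'w measure) \<Rightarrow> bool" where
  "strong_markov M X P \<G> \<longleftrightarrow>
     (\<forall>\<sigma> s x. \<forall>B\<in>sets cemetery_borel. stopping_time \<G> \<sigma> \<longrightarrow>
        (AE \<omega> in P x.
           real_cond_exp (P x) (filtration.pre_sigma (space M) \<G> \<sigma>)
             (indicator {\<omega>' \<in> space M. X (\<sigma> \<omega>' + s) \<omega>' \<in> B}) \<omega> =
           measure (P (X (\<sigma> \<omega>) \<omega>)) {\<omega>' \<in> space M. X s \<omega>' \<in> B}))"

definition quasi_left_continuous ::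
  "(ennreal \<Rightarrow> 'w \<Rightarrow> 'a::topological_space option) \<Rightarrow> ('a option \<Rightarrow> 'w measure) \<Rightarrow>
   (ennreal \<Rightarrow> 'w measure) \<Rightarrow> bool" where
  "quasi_left_continuous X P \<G> \<longleftrightarrow>
     (\<forall>(\<sigma> :: nat \<Rightarrow> 'w \<Rightarrow> ennreal) x.
        (\<forall>n. stopping_time \<G> (\<sigma> n)) \<and> (\<forall>\<omega>. incseq (\<lambda>n. \<sigma> n \<omega>)) \<longrightarrow>
        (AE \<omega> in P x. (SUP n. \<sigma> n \<omega>) < \<infinity> \<longrightarrow>
           limitin cemetery_topology (\<lambda>n. X (\<sigma> n \<omega>) \<omega>) (X (SUP n. \<sigma> n \<omega>) \<omega>) sequentially))"

text \<open>\<open>M\<close> only serves as the measurable space on which all the laws \<open>P x\<close> live.\<close>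

locale hunt_process =
  fixes M :: "'w measure"
    and X :: "ennreal \<Rightarrow> 'w \<Rightarrow> 'a::topological_space option"
    and P :: "'a option \<Rightarrow> 'w measure"
  assumes prob: "\<And>x. prob_space (P x)"
    and sets_P: "\<And>x. sets (P x) = sets M"
    and X_measurable: "\<And>t. X t \<in> measurable M cemetery_borel"
    and P_measurable: "\<And>t B. B \<in> sets cemetery_borel \<Longrightarrow>
          (\<lambda>x. measure (P x) {\<omega> \<in> space M. X t \<omega> \<in> B}) \<in> borel_measurable cemetery_borel"
    and normal: "\<And>x. AE \<omega> in P x. X 0 \<omega> = x"
    and cemetery: "\<And>t. AE \<omega> in P None. X t \<omega> = None"
    and dead: "\<And>\<omega> t. \<omega> \<in> space M \<Longrightarrow> lifetime X \<omega> \<le> t \<Longrightarrow> X t \<omega> = None"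
    and shift: "\<exists>\<theta>. \<forall>t. \<forall>\<omega>\<in>space M. \<theta> t \<omega> \<in> space M \<and> (\<forall>s. X s (\<theta> t \<omega>) = X (s + t) \<omega>)"
    and right_continuous: "\<And>\<omega> t. \<omega> \<in> space M \<Longrightarrow> t < \<infinity> \<Longrightarrow>
          limitin cemetery_topology (\<lambda>s. X s \<omega>) (X t \<omega>) (at_right t)"
    and left_limits: "\<And>\<omega> t. \<omega> \<in> space M \<Longrightarrow> 0 < t \<Longrightarrow> t < \<infinity> \<Longrightarrow>
          \<exists>l. limitin cemetery_topology (\<lambda>s. X s \<omega>) l (at_left t)"
    and hunt: "\<exists>\<G>. admissible_filtration M X \<G> \<and> strong_markov M X P \<G> \<and> quasi_left_continuous X P \<G>"

text \<open>$E_x[u(X_t)]$ for $x \in E$, with the convention $u(\Delta) = 0$.\<close>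

definition transition ::
  "(ennreal \<Rightarrow> 'w \<Rightarrow> 'a option) \<Rightarrow> ('a option \<Rightarrow> 'w measure) \<Rightarrow> real \<Rightarrow> ('a \<Rightarrow> real) \<Rightarrow> 'a \<Rightarrow> real" where
  "transition X P t u x = (\<integral>\<omega>. (case X (ennreal t) \<omega> of None \<Rightarrow> 0 | Some y \<Rightarrow> u y) \<partial>P (Some x))"

definition associated_process ::
  "'a measure \<Rightarrow> ('a \<Rightarrow> real) set \<Rightarrow> (('a \<Rightarrow> real) \<Rightarrow> ('a \<Rightarrow> real) \<Rightarrow> real) \<Rightarrow>
   (ennreal \<Rightarrow> 'w \<Rightarrow> 'a option) \<Rightarrow> ('a option \<Rightarrow> 'w measure) \<Rightarrow> bool" where
  "associated_process m \<F> \<E> X P \<longleftrightarrow> L2_semigroup_of_form m \<F> \<E> (transition X P)"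


section \<open>Heat kernels\<close>

text \<open>Only the values \<open>pk t x y\<close> with \<open>t > 0\<close> are meaningful.\<close>

locale heat_kernel =
  fixes m :: "'a::topological_space measure"
    and X :: "ennreal \<Rightarrow> 'w \<Rightarrow> 'a option"
    and P :: "'a option \<Rightarrow> 'w measure"
    and pk :: "real \<Rightarrow> 'a \<Rightarrow> 'a \<Rightarrow> real"
  assumes kernel_measurable: "(\<lambda>(t, x, y). pk t x y) \<in>
          borel_measurable (restrict_space borel {0<..} \<Otimes>\<^sub>M borel \<Otimes>\<^sub>M borel)"
    and kernel_nonneg: "\<And>t x y. t > 0 \<Longrightarrow> pk t x y \<ge> 0"
    and kernel_transition: "\<And>t x u. t > 0 \<Longrightarrow> u \<in> borel_measurable borel \<Longrightarrow> bounded (range u) \<Longrightarrow>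
          transition X P t u x = (\<integral>y. pk t x y * u y \<partial>m)"
    and chapman_kolmogorov: "\<And>s t x y. s > 0 \<Longrightarrow> t > 0 \<Longrightarrow>
          ennreal (pk (t + s) x y) = (\<integral>\<^sup>+z. ennreal (pk s x z * pk t z y) \<partial>m)"
    and kernel_mass: "\<And>t x. t > 0 \<Longrightarrow> (\<integral>\<^sup>+y. ennreal (pk t x y) \<partial>m) \<le> 1"

definition resolvent_kernel :: "(real \<Rightarrow> 'a \<Rightarrow> 'a \<Rightarrow> real) \<Rightarrow> real \<Rightarrow> 'a \<Rightarrow> 'a \<Rightarrow> ennreal" where
  "resolvent_kernel pk \<alpha> x y = (\<integral>\<^sup>+t\<in>{0<..}. ennreal (exp (- \<alpha> * t) * pk t x y) \<partial>lborel)"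

definition truncated_green :: "(real \<Rightarrow> 'a \<Rightarrow> 'a \<Rightarrow> real) \<Rightarrow> real \<Rightarrow> 'a \<Rightarrow> 'a \<Rightarrow> ennreal" where
  "truncated_green pk t x y = (\<integral>\<^sup>+s\<in>{0<..<t}. ennreal (pk s x y) \<partial>lborel)"

definition heat_kernel_estimates ::
  "(real \<Rightarrow> 'a::metric_space \<Rightarrow> 'a \<Rightarrow> real) \<Rightarrow> real \<Rightarrow> real \<Rightarrow> ereal \<Rightarrow> (real \<Rightarrow> real) \<Rightarrow> bool" where
  "heat_kernel_estimates pk \<nu> \<beta> t\<^sub>0 V \<longleftrightarrow>
     (\<exists>\<Phi>\<^sub>1 \<Phi>\<^sub>2 :: real \<Rightarrow> real.
        (\<forall>s\<ge>0. \<Phi>\<^sub>1 s > 0 \<and> \<Phi>\<^sub>2 s > 0) \<and> antimono_on {0..} \<Phi>\<^sub>1 \<and> antimono_on {0..} \<Phi>\<^sub>2 \<and>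
        (\<integral>\<^sup>+t\<in>{1..}. ennreal (max (V t) (t powr \<nu>) * \<Phi>\<^sub>2 t / t) \<partial>lborel) < \<infinity> \<and>
        (\<forall>x y t. 0 < t \<and> ereal t < t\<^sub>0 \<longrightarrow>
           1 / t powr (\<nu> / \<beta>) * \<Phi>\<^sub>1 (dist x y / t powr (1 / \<beta>)) \<le> pk t x y \<and>
           pk t x y \<le> 1 / t powr (\<nu> / \<beta>) * \<Phi>\<^sub>2 (dist x y / t powr (1 / \<beta>))))"


section \<open>Classes of measures\<close>

text \<open>Real powers in $[0,\infty]$ with positive exponent.\<close>

definition ennreal_rpow :: "ennreal \<Rightarrow> real \<Rightarrow> ennreal" where
  "ennreal_rpow a p = (if a = \<infinity> then \<infinity> else ennreal (enn2real a powr p))"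

definition ball_sup ::
  "'a::metric_space measure \<Rightarrow> real \<Rightarrow> ('a \<Rightarrow> 'a \<Rightarrow> ennreal) \<Rightarrow> real \<Rightarrow> ennreal" where
  "ball_sup \<mu> p k r = (SUP x. \<integral>\<^sup>+y\<in>ball x r. ennreal_rpow (k x y) p \<partial>\<mu>)"

text \<open>
  Meant for \<open>\<nu> \<ge> \<beta>\<close>. In the logarithmic case only radii below 1 are meaningful; for larger radii
  \<open>ennreal\<close> truncates the negative logarithm to 0.
\<close>

definition green_radial :: "real \<Rightarrow> real \<Rightarrow> real \<Rightarrow> ennreal" where
  "green_radial \<nu> \<beta> r =
     (if r = 0 then \<infinity> else if \<nu> > \<beta> then ennreal (r powr (\<beta> - \<nu>)) else ennreal (ln (1 / r)))"

definition green :: "real \<Rightarrow> real \<Rightarrow> 'a::metric_space \<Rightarrow> 'a \<Rightarrow> ennreal" where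
  "green \<nu> \<beta> x y = green_radial \<nu> \<beta> (dist x y)"

definition dynkin_class :: "real \<Rightarrow> real \<Rightarrow> real \<Rightarrow> 'a::metric_space measure set" where
  "dynkin_class \<nu> \<beta> p =
     {\<mu>. sets \<mu> = sets borel \<and>
         (\<exists>r>0. (\<nu> = \<beta> \<longrightarrow> r < 1) \<and> ball_sup \<mu> p (green \<nu> \<beta>) r < \<infinity>)}"

definition kato_class :: "real \<Rightarrow> real \<Rightarrow> real \<Rightarrow> 'a::metric_space measure set" where
  "kato_class \<nu> \<beta> p =
     {\<mu>. sets \<mu> = sets borel \<and> (ball_sup \<mu> p (green \<nu> \<beta>) \<longlongrightarrow> 0) (at_right 0)}"

end

theory Submission
  imports Defs "HOL-Real_Asymp.Real_Asymp"
begin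

text \<open>
  Both families of potentials are time integrals of the heat kernel against a weight:
  \<open>exp (- \<alpha> * s)\<close> for the resolvent kernel and the indicator of \<open>s < t\<close> for the truncated one. Any
  weight that is bounded below near \<open>s = 0\<close> and decays exponentially produces a potential that is
  comparable to the Green function \<open>green \<nu> \<beta>\<close> near the diagonal, up to multiplicative constants
  (\<open>weighted_heat_kernel_comparable_green\<close>). Comparable kernels have comparable ball suprema, so the
  smallness and the finiteness conditions that define the two classes of measures may be tested on
  any of these potentials (\<open>kato_class_iff_comparable\<close>, \<open>dynkin_class_iff_comparable\<close>).

  The comparison comes from splitting time at the diffusive scale \<open>d\<^sup>\<beta>\<close> of the distance
  \<open>d = dist x y\<close> and at a fixed small time \<open>\<tau>\<close>.
  \<^item> For \<open>d\<^sup>\<beta> \<le> s \<le> \<tau>\<close> the argument of \<open>\<Phi>\<^sub>1\<close> is at most 1, and \<open>\<Phi>\<^sub>2\<close> is bounded, hence the kernel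
    is comparable to \<open>s\<close> to the power \<open>- \<nu> / \<beta>\<close>, whose integral over this range is
    \<open>B * G(d) + \<kappa>\<close> with \<open>B > 0\<close>, in the power case as well as in the logarithmic one
    (\<open>power_integral_eq_green_profile\<close>). As \<open>G(d)\<close> tends to infinity at the diagonal, the constant
    \<open>\<kappa>\<close> is eventually negligible. This range alone gives the lower bound.
  \<^item> For \<open>s \<le> d\<^sup>\<beta>\<close> the tail integral of \<open>\<Phi>\<^sub>2\<close> and monotonicity give the pointwise decay
    \<open>\<Phi>\<^sub>2(u) \<le> A u\<^sup>-\<^sup>\<nu>\<close> (\<open>antimono_power_decay\<close>), hence the kernel is at most \<open>A d\<^sup>-\<^sup>\<nu>\<close>; an interval
    of length \<open>d\<^sup>\<beta>\<close> contributes \<open>A d\<^sup>\<beta>\<^sup>-\<^sup>\<nu>\<close>, which is at most \<open>A * G(d)\<close> near the diagonal.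
  \<^item> For \<open>s > \<tau>\<close> the Chapman-Kolmogorov equation bounds the kernel by its supremum at time \<open>\<tau>\<close>
    (\<open>heat_kernel_le_of_bound_at_time\<close>), and the exponential decay of the weight leaves a constant.
\<close>

section \<open>Ball suprema of comparable kernels\<close>

lemma ennreal_rpow_mono:
  assumes "a \<le> b" "p \<ge> 0"
  shows "ennreal_rpow a p \<le> ennreal_rpow b p"
proof (cases "b = \<infinity>")
  case False
  then have "a < \<infinity>" "b < \<infinity>"
    using assms(1) by (auto simp: top.not_eq_extremum intro: le_less_trans)
  then show ?thesis
    using assms by (auto simp: ennreal_rpow_def intro!: ennreal_leI powr_mono2 enn2real_mono)
qed (simp add: ennreal_rpow_def)

lemma ennreal_rpow_cmult:
  assumes "c > 0"
  shows "ennreal_rpow (ennreal c * a) p = ennreal (c powr p) * ennreal_rpow a p"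
  using assms
  by (auto simp: ennreal_rpow_def ennreal_mult_eq_top_iff ennreal_mult_top enn2real_mult powr_mult
      simp flip: ennreal_mult')

lemma measurable_ennreal_rpow [measurable]:
  assumes [measurable]: "f \<in> borel_measurable N"
  shows "(\<lambda>x. ennreal_rpow (f x) p) \<in> borel_measurable N"
  unfolding ennreal_rpow_def by measurable

lemma measurable_green:
  "green \<nu> \<beta> x \<in> borel_measurable borel"
proof -
  have "green_radial \<nu> \<beta> \<in> borel_measurable borel"
    unfolding green_radial_def by measurable
  moreover have "dist x \<in> borel_measurable borel"
    by (intro borel_measurable_continuous_onI continuous_intros)
  ultimately show ?thesis
    unfolding green_def by (rule measurable_compose[rotated])
qed

lemma ball_sup_mono_radius:
  assumes "r \<le> s"
  shows "ball_sup \<mu> p k r \<le> ball_sup \<mu> p k s"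
  unfolding ball_sup_def using assms
  by (intro SUP_mono' nn_integral_mono mult_left_mono) (auto simp: indicator_def)

lemma nn_integral_ball_le_ball_sup:
  "(\<integral>\<^sup>+y\<in>ball x r. ennreal_rpow (k x y) p \<partial>\<mu>) \<le> ball_sup \<mu> p k r"
  unfolding ball_sup_def by (rule SUP_upper) simp

text \<open>
  In this bound and the next one, only the majorant, respectively the minorant, has to be measurable:
  the constant is pulled out of its integral, and the kernel under study enters through monotonicity
  only. The Green function will take the place of \<open>k'\<close>, and a potential that of \<open>k\<close>.
\<close>

lemma ball_sup_le_of_kernel_le:
  fixes \<mu> :: "'a::metric_space measure"
  assumes "sets \<mu> = sets borel" "\<And>x. k' x \<in> borel_measurable borel" "p \<ge> 0" "C > 0"
    and le: "\<And>x y. dist x y < r \<Longrightarrow> k x y \<le> ennreal C * k' x y"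
  shows "ball_sup \<mu> p k r \<le> ennreal (C powr p) * ball_sup \<mu> p k' r"
  unfolding ball_sup_def[of \<mu> p k]
proof (rule SUP_least)
  fix x :: 'a
  note [measurable] = assms(2) and [measurable_cong] = assms(1)
  have [measurable]: "ball x r \<in> sets borel"
    by simp
  have "(\<integral>\<^sup>+y\<in>ball x r. ennreal_rpow (k x y) p \<partial>\<mu>)
      \<le> (\<integral>\<^sup>+y. ennreal (C powr p) * (ennreal_rpow (k' x y) p * indicator (ball x r) y) \<partial>\<mu>)"
    using le \<open>p \<ge> 0\<close> \<open>C > 0\<close>
    by (intro nn_integral_mono)
       (auto simp: indicator_def simp flip: ennreal_rpow_cmult intro!: ennreal_rpow_mono)
  also have "\<dots> = ennreal (C powr p) * (\<integral>\<^sup>+y\<in>ball x r. ennreal_rpow (k' x y) p \<partial>\<mu>)"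
    by (rule nn_integral_cmult) measurable
  also have "\<dots> \<le> ennreal (C powr p) * ball_sup \<mu> p k' r"
    by (intro mult_left_mono nn_integral_ball_le_ball_sup) simp
  finally show "(\<integral>\<^sup>+y\<in>ball x r. ennreal_rpow (k x y) p \<partial>\<mu>) \<le> \<dots>" .
qed

lemma ball_sup_ge_of_kernel_ge:
  fixes \<mu> :: "'a::metric_space measure"
  assumes "sets \<mu> = sets borel" "\<And>x. k' x \<in> borel_measurable borel" "p \<ge> 0" "c > 0"
    and ge: "\<And>x y. dist x y < r \<Longrightarrow> ennreal c * k' x y \<le> k x y"
  shows "ennreal (c powr p) * ball_sup \<mu> p k' r \<le> ball_sup \<mu> p k r"
  unfolding ball_sup_def[of \<mu> p k'] SUP_mult_left_ennreal
proof (rule SUP_least)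
  fix x :: 'a
  note [measurable] = assms(2) and [measurable_cong] = assms(1)
  have [measurable]: "ball x r \<in> sets borel"
    by simp
  have "ennreal (c powr p) * (\<integral>\<^sup>+y\<in>ball x r. ennreal_rpow (k' x y) p \<partial>\<mu>)
      = (\<integral>\<^sup>+y. ennreal (c powr p) * (ennreal_rpow (k' x y) p * indicator (ball x r) y) \<partial>\<mu>)"
    by (rule nn_integral_cmult[symmetric]) measurable
  also have "\<dots> \<le> (\<integral>\<^sup>+y\<in>ball x r. ennreal_rpow (k x y) p \<partial>\<mu>)"
    using ge \<open>p \<ge> 0\<close> \<open>c > 0\<close>
    by (intro nn_integral_mono)
       (auto simp: indicator_def simp flip: ennreal_rpow_cmult intro!: ennreal_rpow_mono)
  also have "\<dots> \<le> ball_sup \<mu> p k r"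
    by (rule nn_integral_ball_le_ball_sup)
  finally show "ennreal (c powr p) * (\<integral>\<^sup>+y\<in>ball x r. ennreal_rpow (k' x y) p \<partial>\<mu>) \<le> \<dots>" .
qed

definition comparable_near_diagonal ::
  "('a::metric_space \<Rightarrow> 'a \<Rightarrow> ennreal) \<Rightarrow> ('a \<Rightarrow> 'a \<Rightarrow> ennreal) \<Rightarrow> bool" where
  "comparable_near_diagonal k k' \<longleftrightarrow>
     (\<exists>c>0. \<exists>C>0. \<exists>R>0. \<forall>x y. dist x y < R \<longrightarrow>
        ennreal c * k' x y \<le> k x y \<and> k x y \<le> ennreal C * k' x y)"

lemma ball_sup_comparable:
  assumes "comparable_near_diagonal k k'" "sets \<mu> = sets borel"
    and "\<And>x. k' x \<in> borel_measurable borel" "p \<ge> 0"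
  obtains a b R where "R > 0"
    and "\<And>r. r \<le> R \<Longrightarrow> ball_sup \<mu> p k r \<le> ennreal a * ball_sup \<mu> p k' r"
    and "\<And>r. r \<le> R \<Longrightarrow> ball_sup \<mu> p k' r \<le> ennreal b * ball_sup \<mu> p k r"
proof -
  from assms(1) obtain c C R where cCR: "c > 0" "C > 0" "R > 0"
    and bd: "\<And>x y. dist x y < R \<Longrightarrow> ennreal c * k' x y \<le> k x y \<and> k x y \<le> ennreal C * k' x y"
    unfolding comparable_near_diagonal_def by metis
  show thesis
  proof (rule that[of R "C powr p" "inverse (c powr p)"])
    fix r assume r: "r \<le> R"
    show "ball_sup \<mu> p k r \<le> ennreal (C powr p) * ball_sup \<mu> p k' r"
      using bd r cCR by (intro ball_sup_le_of_kernel_le assms) auto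
    have "ennreal (c powr p) * ball_sup \<mu> p k' r \<le> ball_sup \<mu> p k r"
      using bd r cCR by (intro ball_sup_ge_of_kernel_ge assms) auto
    then have "ennreal (inverse (c powr p)) * (ennreal (c powr p) * ball_sup \<mu> p k' r)
        \<le> ennreal (inverse (c powr p)) * ball_sup \<mu> p k r"
      by (rule mult_left_mono) simp
    moreover have "ennreal (inverse (c powr p)) * ennreal (c powr p) = 1"
      using cCR by (simp flip: ennreal_mult')
    ultimately show "ball_sup \<mu> p k' r \<le> ennreal (inverse (c powr p)) * ball_sup \<mu> p k r"
      by (simp flip: mult.assoc)
  qed (use cCR in auto)
qed

lemma tendsto_0_of_le_cmult_ennreal:
  fixes f g :: "real \<Rightarrow> ennreal"
  assumes "(g \<longlongrightarrow> 0) (at_right 0)" "R > 0" "\<And>r. r \<le> R \<Longrightarrow> f r \<le> ennreal a * g r"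
  shows "(f \<longlongrightarrow> 0) (at_right 0)"
proof (rule tendsto_sandwich[where f = "\<lambda>_. 0"])
  show "\<forall>\<^sub>F r in at_right 0. f r \<le> ennreal a * g r"
    using assms(2,3) by (auto simp: eventually_at_right_field)
  show "((\<lambda>r. ennreal a * g r) \<longlongrightarrow> 0) (at_right 0)"
    using ennreal_tendsto_cmult[OF _ assms(1), of "ennreal a"] by simp
qed auto

lemma kato_class_iff_comparable:
  assumes "comparable_near_diagonal k (green \<nu> \<beta>)" "sets \<mu> = sets borel" "p \<ge> 0"
  shows "\<mu> \<in> kato_class \<nu> \<beta> p \<longleftrightarrow> (ball_sup \<mu> p k \<longlongrightarrow> 0) (at_right 0)"
proof -
  obtain a b R where "R > 0"
    "\<And>r. r \<le> R \<Longrightarrow> ball_sup \<mu> p k r \<le> ennreal a * ball_sup \<mu> p (green \<nu> \<beta>) r"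
    "\<And>r. r \<le> R \<Longrightarrow> ball_sup \<mu> p (green \<nu> \<beta>) r \<le> ennreal b * ball_sup \<mu> p k r"
    using ball_sup_comparable[OF assms(1,2) measurable_green assms(3)] by metis
  then show ?thesis
    unfolding kato_class_def using assms(2) by (auto intro: tendsto_0_of_le_cmult_ennreal)
qed

text \<open>
  Finiteness for some radius passes to smaller radii by monotonicity, so the radius may be shrunk
  into the range where the kernels are comparable, and below 1 as the logarithmic case demands.
\<close>

lemma dynkin_class_iff_comparable:
  assumes "comparable_near_diagonal k (green \<nu> \<beta>)" "sets \<mu> = sets borel" "p \<ge> 0"
  shows "\<mu> \<in> dynkin_class \<nu> \<beta> p \<longleftrightarrow> (\<exists>r>0. ball_sup \<mu> p k r < \<infinity>)"
proof -
  obtain a b R where R: "R > 0"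
    and up: "\<And>r. r \<le> R \<Longrightarrow> ball_sup \<mu> p k r \<le> ennreal a * ball_sup \<mu> p (green \<nu> \<beta>) r"
    and lo: "\<And>r. r \<le> R \<Longrightarrow> ball_sup \<mu> p (green \<nu> \<beta>) r \<le> ennreal b * ball_sup \<mu> p k r"
    using ball_sup_comparable[OF assms(1,2) measurable_green assms(3)] by metis
  show ?thesis
  proof
    assume "\<mu> \<in> dynkin_class \<nu> \<beta> p"
    then obtain r where r: "r > 0" "ball_sup \<mu> p (green \<nu> \<beta>) r < \<infinity>"
      unfolding dynkin_class_def by auto
    have "ball_sup \<mu> p k (min r R) \<le> ennreal a * ball_sup \<mu> p (green \<nu> \<beta>) (min r R)"
      by (rule up) simp
    also have "\<dots> \<le> ennreal a * ball_sup \<mu> p (green \<nu> \<beta>) r"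
      by (intro mult_left_mono ball_sup_mono_radius) auto
    also have "\<dots> < \<infinity>"
      using r by (simp add: ennreal_mult_less_top)
    finally show "\<exists>r>0. ball_sup \<mu> p k r < \<infinity>"
      using r R by (intro exI[of _ "min r R"]) auto
  next
    assume "\<exists>r>0. ball_sup \<mu> p k r < \<infinity>"
    then obtain r where r: "r > 0" "ball_sup \<mu> p k r < \<infinity>"
      by auto
    define s where "s = min (min r R) (1/2)"
    have s: "s > 0" "s < 1" "s \<le> r" "s \<le> R"
      using r R by (auto simp: s_def)
    have "ball_sup \<mu> p (green \<nu> \<beta>) s \<le> ennreal b * ball_sup \<mu> p k s"
      using s by (intro lo)
    also have "\<dots> \<le> ennreal b * ball_sup \<mu> p k r"
      using s by (intro mult_left_mono ball_sup_mono_radius) auto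
    also have "\<dots> < \<infinity>"
      using r by (simp add: ennreal_mult_less_top)
    finally show "\<mu> \<in> dynkin_class \<nu> \<beta> p"
      unfolding dynkin_class_def using s assms(2) by auto
  qed
qed

section \<open>The Green function as a time integral\<close>

text \<open>
  The real function behind \<open>green_radial\<close>, free of the value at 0 and of the truncation of
  negative logarithms, so that it can be computed with.
\<close>

definition green_profile :: "real \<Rightarrow> real \<Rightarrow> real \<Rightarrow> real" where
  "green_profile \<nu> \<beta> r = (if \<nu> > \<beta> then r powr (\<beta> - \<nu>) else ln (1 / r))"

lemma green_eq_profile:
  "green \<nu> \<beta> x y = (if dist x y = 0 then \<infinity> else ennreal (green_profile \<nu> \<beta> (dist x y)))"
  by (simp add: green_def green_radial_def green_profile_def)

lemma green_profile_at_top: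
  "filterlim (green_profile \<nu> \<beta>) at_top (at_right 0)"
proof (cases "\<nu> > \<beta>")
  case True
  then have "filterlim (\<lambda>r::real. r powr (\<beta> - \<nu>)) at_top (at_right 0)"
    by real_asymp
  with True show ?thesis
    by (simp add: green_profile_def[abs_def])
next
  case False
  have "filterlim (\<lambda>r::real. ln (1 / r)) at_top (at_right 0)"
    by real_asymp
  with False show ?thesis
    by (simp add: green_profile_def[abs_def])
qed

text \<open>
  The antiderivative at the lower endpoint \<open>d\<^sup>\<beta>\<close> is a multiple of the Green profile at \<open>d\<close>, and at
  the upper endpoint it is the constant \<open>\<kappa>\<close>. Writing the power and the logarithmic case in the same
  form lets everything that follows treat them together.
\<close>

lemma power_integral_eq_green_profile:
  fixes \<nu> \<beta> \<tau> :: real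
  assumes "\<beta> > 0" "\<nu> \<ge> \<beta>" "\<tau> > 0"
  obtains B \<kappa> where "B > 0"
    and "\<And>d. d > 0 \<Longrightarrow> d powr \<beta> \<le> \<tau> \<Longrightarrow>
      (\<integral>\<^sup>+s\<in>{d powr \<beta>..\<tau>}. ennreal (s powr (- (\<nu> / \<beta>))) \<partial>lborel)
        = ennreal (B * green_profile \<nu> \<beta> d + \<kappa>)"
proof (cases "\<nu> > \<beta>")
  case True
  define e where "e = 1 - \<nu> / \<beta>"
  have e: "e < 0" "\<beta> * e = \<beta> - \<nu>"
    using True assms by (auto simp: e_def field_simps)
  show thesis
  proof (rule that[of "- 1 / e" "\<tau> powr e / e"])
    fix d :: real assume d: "d > 0" "d powr \<beta> \<le> \<tau>"
    have "(\<integral>\<^sup>+s\<in>{d powr \<beta>..\<tau>}. ennreal (s powr (- (\<nu> / \<beta>))) \<partial>lborel)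
        = ennreal (\<tau> powr e / e - (d powr \<beta>) powr e / e)"
    proof (rule nn_integral_FTC_Icc[where F = "\<lambda>s. s powr e / e"])
      fix s assume "s \<in> {d powr \<beta>..\<tau>}"
      then have "s > 0"
        using d(1) by (auto intro: less_le_trans[of 0 "d powr \<beta>"])
      then show "((\<lambda>s. s powr e / e) has_real_derivative s powr (- (\<nu> / \<beta>))) (at s)"
        using e by (auto intro!: derivative_eq_intros simp: e_def)
    qed (use d in auto)
    also have "\<tau> powr e / e - (d powr \<beta>) powr e / e = - 1 / e * green_profile \<nu> \<beta> d + \<tau> powr e / e"
      using True e by (simp add: green_profile_def powr_powr)
    finally show "(\<integral>\<^sup>+s\<in>{d powr \<beta>..\<tau>}. ennreal (s powr (- (\<nu> / \<beta>))) \<partial>lborel) = ennreal \<dots>" .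
  qed (use e in \<open>simp add: field_simps\<close>)
next
  case False
  with assms have [simp]: "\<nu> = \<beta>" by simp
  show thesis
  proof (rule that[of \<beta> "ln \<tau>"])
    fix d :: real assume d: "d > 0" "d powr \<beta> \<le> \<tau>"
    have "(\<integral>\<^sup>+s\<in>{d powr \<beta>..\<tau>}. ennreal (s powr (- (\<nu> / \<beta>))) \<partial>lborel)
        = ennreal (ln \<tau> - ln (d powr \<beta>))"
    proof (rule nn_integral_FTC_Icc[where F = ln])
      fix s assume "s \<in> {d powr \<beta>..\<tau>}"
      then have "s > 0"
        using d(1) by (auto intro: less_le_trans[of 0 "d powr \<beta>"])
      then show "(ln has_real_derivative s powr (- (\<nu> / \<beta>))) (at s)"
        using assms by (auto intro!: derivative_eq_intros simp: powr_minus divide_simps)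
    qed (use d in auto)
    also have "ln \<tau> - ln (d powr \<beta>) = \<beta> * green_profile \<nu> \<beta> d + ln \<tau>"
      using d by (simp add: green_profile_def ln_powr ln_div)
    finally show "(\<integral>\<^sup>+s\<in>{d powr \<beta>..\<tau>}. ennreal (s powr (- (\<nu> / \<beta>))) \<partial>lborel) = ennreal \<dots>" .
  qed (use assms in simp)
qed

text \<open>
  The profile blows up at 0, so near 0 it absorbs the additive constant \<open>\<kappa>\<close> into half of the
  leading term. The other conclusions are the remaining facts that make \<open>d\<close> small enough for the
  upper bound: both the contribution of order \<open>d\<^sup>\<beta>\<^sup>-\<^sup>\<nu>\<close> from very short times and the bounded one from
  long times are at most a multiple of the profile.
\<close>

lemma power_integral_comparable_green_profile:
  fixes \<nu> \<beta> \<tau> :: real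
  assumes "\<beta> > 0" "\<nu> \<ge> \<beta>" "\<tau> > 0"
  obtains c C R where "c > 0" "C > 0" "R > 0"
    and "\<And>d. 0 < d \<Longrightarrow> d < R \<Longrightarrow> d powr \<beta> \<le> \<tau>"
    and "\<And>d. 0 < d \<Longrightarrow> d < R \<Longrightarrow> 1 \<le> green_profile \<nu> \<beta> d"
    and "\<And>d. 0 < d \<Longrightarrow> d < R \<Longrightarrow> d powr (\<beta> - \<nu>) \<le> green_profile \<nu> \<beta> d"
    and "\<And>d. 0 < d \<Longrightarrow> d < R \<Longrightarrow> ennreal (c * green_profile \<nu> \<beta> d)
          \<le> (\<integral>\<^sup>+s\<in>{d powr \<beta>..\<tau>}. ennreal (s powr (- (\<nu> / \<beta>))) \<partial>lborel)"
    and "\<And>d. 0 < d \<Longrightarrow> d < R \<Longrightarrow>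
          (\<integral>\<^sup>+s\<in>{d powr \<beta>..\<tau>}. ennreal (s powr (- (\<nu> / \<beta>))) \<partial>lborel)
          \<le> ennreal (C * green_profile \<nu> \<beta> d)"
proof -
  let ?g = "green_profile \<nu> \<beta>"
  obtain B \<kappa> where B: "B > 0" and eq: "\<And>d. d > 0 \<Longrightarrow> d powr \<beta> \<le> \<tau> \<Longrightarrow>
      (\<integral>\<^sup>+s\<in>{d powr \<beta>..\<tau>}. ennreal (s powr (- (\<nu> / \<beta>))) \<partial>lborel) = ennreal (B * ?g d + \<kappa>)"
    using power_integral_eq_green_profile[OF assms] by metis
  have "((\<lambda>d::real. d powr \<beta>) \<longlongrightarrow> 0) (at_right 0)"
    using assms(1) by real_asymp
  then have "\<forall>\<^sub>F d in at_right 0. d powr \<beta> < \<tau>"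
    using assms(3) by (rule order_tendstoD)
  moreover have "\<forall>\<^sub>F d in at_right 0. max 1 (2 * \<bar>\<kappa>\<bar> / B) \<le> ?g d"
    using green_profile_at_top[unfolded filterlim_at_top] by blast
  ultimately have "\<forall>\<^sub>F d in at_right 0. d powr \<beta> < \<tau> \<and> max 1 (2 * \<bar>\<kappa>\<bar> / B) \<le> ?g d"
    by (rule eventually_conj)
  then obtain R where R: "R > 0"
    and ev: "\<And>d. 0 < d \<Longrightarrow> d < R \<Longrightarrow> d powr \<beta> < \<tau> \<and> max 1 (2 * \<bar>\<kappa>\<bar> / B) \<le> ?g d"
    unfolding eventually_at_right_field by auto
  have \<kappa>: "2 * \<bar>\<kappa>\<bar> \<le> B * ?g d" if "0 < d" "d < R" for d
    using ev[OF that] B by (simp add: field_simps)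
  show thesis
  proof (rule that[of "B / 2" "2 * B" R])
    fix d assume d: "0 < d" "d < R"
    show "d powr \<beta> \<le> \<tau>" "1 \<le> ?g d"
      using ev[OF d] by auto
    then show "d powr (\<beta> - \<nu>) \<le> ?g d"
      using assms d by (auto simp: green_profile_def)
    note eq = eq[OF d(1) \<open>d powr \<beta> \<le> \<tau>\<close>]
    have "B / 2 * ?g d \<le> B * ?g d + \<kappa>" "B * ?g d + \<kappa> \<le> 2 * B * ?g d"
      using \<kappa>[OF d] by linarith+
    then show "ennreal (B / 2 * ?g d)
        \<le> (\<integral>\<^sup>+s\<in>{d powr \<beta>..\<tau>}. ennreal (s powr (- (\<nu> / \<beta>))) \<partial>lborel)"
      "(\<integral>\<^sup>+s\<in>{d powr \<beta>..\<tau>}. ennreal (s powr (- (\<nu> / \<beta>))) \<partial>lborel) \<le> ennreal (2 * B * ?g d)"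
      unfolding eq by (auto intro: ennreal_leI)
  qed (use B R in auto)
qed

section \<open>Two-sided bounds for potentials\<close>

definition time_integral :: "(real \<Rightarrow> 'a \<Rightarrow> 'a \<Rightarrow> real) \<Rightarrow> 'a \<Rightarrow> 'a \<Rightarrow> ennreal" where
  "time_integral h x y = (\<integral>\<^sup>+s\<in>{0<..}. ennreal (h s x y) \<partial>lborel)"

text \<open>
  The lower bound on the kernel holds on \<open>[d\<^sup>\<beta>, \<tau>]\<close> for every \<open>d \<ge> dist x y\<close>, and integrates to a
  multiple of the profile at \<open>d\<close>. Off the diagonal take \<open>d = dist x y\<close>; on the diagonal let \<open>d\<close>
  tend to 0, which shows that the time integral is infinite there, like the Green function.
\<close>

lemma green_le_time_integral:
  fixes h :: "real \<Rightarrow> 'a::metric_space \<Rightarrow> 'a \<Rightarrow> real"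
  assumes "\<beta> > 0" "\<nu> \<ge> \<beta>" "\<tau> > 0" "a > 0"
    and lower: "\<And>s x y. 0 < s \<Longrightarrow> s \<le> \<tau> \<Longrightarrow> dist x y powr \<beta> \<le> s \<Longrightarrow>
          a * s powr (- (\<nu> / \<beta>)) \<le> h s x y"
  obtains c R where "c > 0" "R > 0"
    and "\<And>x y. dist x y < R \<Longrightarrow> ennreal c * green \<nu> \<beta> x y \<le> time_integral h x y"
proof -
  obtain c R where c: "c > 0" "R > 0"
    and lo: "\<And>d. 0 < d \<Longrightarrow> d < R \<Longrightarrow> ennreal (c * green_profile \<nu> \<beta> d)
          \<le> (\<integral>\<^sup>+s\<in>{d powr \<beta>..\<tau>}. ennreal (s powr (- (\<nu> / \<beta>))) \<partial>lborel)"
    using power_integral_comparable_green_profile[OF assms(1-3)] by metis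
  have main: "ennreal (a * c * green_profile \<nu> \<beta> d) \<le> time_integral h x y"
    if d: "0 < d" "d < R" "dist x y \<le> d" for d x y
  proof -
    have "ennreal (a * c * green_profile \<nu> \<beta> d) = ennreal a * ennreal (c * green_profile \<nu> \<beta> d)"
      using \<open>a > 0\<close> by (simp add: mult.assoc flip: ennreal_mult')
    also have "\<dots> \<le> ennreal a *
        (\<integral>\<^sup>+s\<in>{d powr \<beta>..\<tau>}. ennreal (s powr (- (\<nu> / \<beta>))) \<partial>lborel)"
      using lo[OF d(1,2)] by (rule mult_left_mono) simp
    also have "\<dots> =
        (\<integral>\<^sup>+s. ennreal a * (ennreal (s powr (- (\<nu> / \<beta>))) * indicator {d powr \<beta>..\<tau>} s) \<partial>lborel)"
      by (rule nn_integral_cmult[symmetric]) measurable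
    also have "\<dots> \<le> time_integral h x y"
      unfolding time_integral_def
    proof (rule nn_integral_mono)
      fix s :: real
      show "ennreal a * (ennreal (s powr (- (\<nu> / \<beta>))) * indicator {d powr \<beta>..\<tau>} s)
          \<le> ennreal (h s x y) * indicator {0<..} s"
      proof (cases "s \<in> {d powr \<beta>..\<tau>}")
        case True
        then have s: "0 < s" "s \<le> \<tau>" "d powr \<beta> \<le> s"
          using d(1) by (auto intro: less_le_trans[of 0 "d powr \<beta>"])
        have "dist x y powr \<beta> \<le> d powr \<beta>"
          using d assms(1) by (intro powr_mono2) auto
        then have "a * s powr (- (\<nu> / \<beta>)) \<le> h s x y"
          using s by (intro lower) auto
        then show ?thesis
          using True s \<open>a > 0\<close> by (auto simp flip: ennreal_mult' intro: ennreal_leI)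
      qed auto
    qed
    finally show ?thesis .
  qed
  show thesis
  proof (rule that[of "a * c" R])
    fix x y :: 'a assume xy: "dist x y < R"
    show "ennreal (a * c) * green \<nu> \<beta> x y \<le> time_integral h x y"
    proof (cases "x = y")
      case False
      then show ?thesis
        using main[of "dist x y" x y] xy assms(4) c
        by (simp add: green_eq_profile flip: ennreal_mult')
    next
      case True
      have "time_integral h x y = \<infinity>"
      proof (rule ccontr)
        assume "time_integral h x y \<noteq> \<infinity>"
        then obtain q where q: "q \<ge> 0" "time_integral h x y = ennreal q"
          by (cases "time_integral h x y") auto
        \<comment> \<open>a finite value \<open>q\<close> is exceeded by the lower bound at a small distance \<open>d\<close>\<close>
        have "\<forall>\<^sub>F d in at_right 0. q / (a * c) + 1 \<le> green_profile \<nu> \<beta> d"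
          using green_profile_at_top[unfolded filterlim_at_top] by blast
        moreover have "\<forall>\<^sub>F d in at_right 0. 0 < d \<and> d < R"
          using c(2) by (auto simp: eventually_at_right_field)
        ultimately have "\<forall>\<^sub>F d in at_right 0. q / (a * c) + 1 \<le> green_profile \<nu> \<beta> d \<and> 0 < d \<and> d < R"
          by (rule eventually_conj)
        then obtain d where d: "q / (a * c) + 1 \<le> green_profile \<nu> \<beta> d" "0 < d" "d < R"
          using eventually_happens'[of "at_right (0::real)"] by (auto simp: trivial_limit_at_right_real)
        have "q < a * c * green_profile \<nu> \<beta> d"
          using d(1) assms(4) c(1) by (simp add: field_simps) (smt (verit) mult_pos_pos)
        moreover have "ennreal (a * c * green_profile \<nu> \<beta> d) \<le> ennreal q"
          using main[of d x y] d True q by simp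
        ultimately show False
          using q by (simp add: ennreal_le_iff)
      qed
      then show ?thesis by simp
    qed
  qed (use assms(4) c in auto)
qed

text \<open>
  Time is cut at \<open>d\<^sup>\<beta>\<close> and \<open>\<tau>\<close>; the three pieces contribute the three summands of the constant.
  On the diagonal the Green function is infinite and there is nothing to bound.
\<close>

lemma time_integral_le_green:
  fixes h :: "real \<Rightarrow> 'a::metric_space \<Rightarrow> 'a \<Rightarrow> real"
  assumes "\<beta> > 0" "\<nu> \<ge> \<beta>" "\<tau> > 0" "\<alpha> > 0" "A > 0" "K \<ge> 0"
    and off: "\<And>s x y. x \<noteq> y \<Longrightarrow> 0 < s \<Longrightarrow> s \<le> \<tau> \<Longrightarrow> s \<le> dist x y powr \<beta> \<Longrightarrow>
          h s x y \<le> A * dist x y powr (- \<nu>)"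
    and on: "\<And>s x y. 0 < s \<Longrightarrow> s \<le> \<tau> \<Longrightarrow> h s x y \<le> A * s powr (- (\<nu> / \<beta>))"
    and late: "\<And>s x y. \<tau> < s \<Longrightarrow> h s x y \<le> K * exp (- \<alpha> * s)"
  obtains C R where "C > 0" "R > 0"
    and "\<And>x y. dist x y < R \<Longrightarrow> time_integral h x y \<le> ennreal C * green \<nu> \<beta> x y"
proof -
  obtain c C R where C: "c > 0" "C > 0" "R > 0"
    and small: "\<And>d. 0 < d \<Longrightarrow> d < R \<Longrightarrow> d powr \<beta> \<le> \<tau>"
    and one: "\<And>d. 0 < d \<Longrightarrow> d < R \<Longrightarrow> 1 \<le> green_profile \<nu> \<beta> d"
    and pow: "\<And>d. 0 < d \<Longrightarrow> d < R \<Longrightarrow> d powr (\<beta> - \<nu>) \<le> green_profile \<nu> \<beta> d"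
    and "\<And>d. 0 < d \<Longrightarrow> d < R \<Longrightarrow> ennreal (c * green_profile \<nu> \<beta> d)
          \<le> (\<integral>\<^sup>+s\<in>{d powr \<beta>..\<tau>}. ennreal (s powr (- (\<nu> / \<beta>))) \<partial>lborel)"
    and up: "\<And>d. 0 < d \<Longrightarrow> d < R \<Longrightarrow>
          (\<integral>\<^sup>+s\<in>{d powr \<beta>..\<tau>}. ennreal (s powr (- (\<nu> / \<beta>))) \<partial>lborel)
          \<le> ennreal (C * green_profile \<nu> \<beta> d)"
    by (rule power_integral_comparable_green_profile[OF assms(1-3)]) (rule that)
  have exp_int: "(\<integral>\<^sup>+s\<in>{0..}. ennreal (exp (- \<alpha> * s)) \<partial>lborel) = ennreal (1 / \<alpha>)"
  proof -
    have "(\<integral>\<^sup>+s\<in>{0..}. ennreal (exp (- \<alpha> * s)) \<partial>lborel) = ennreal (0 - (- exp (- \<alpha> * 0) / \<alpha>))"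
    proof (rule nn_integral_FTC_atLeast[where F = "\<lambda>s. - exp (- \<alpha> * s) / \<alpha>"])
      show "((\<lambda>s. - exp (- \<alpha> * s) / \<alpha>) \<longlongrightarrow> 0) at_top"
        using assms(4) by real_asymp
    qed (use assms(4) in \<open>auto intro!: derivative_eq_intros\<close>)
    then show ?thesis by simp
  qed
  define D where "D = A + A * C + K / \<alpha>"
  have D: "D > 0"
    unfolding D_def using assms C by (auto intro!: add_pos_nonneg)
  show thesis
  proof (rule that[of D R])
    fix x y :: 'a assume xy: "dist x y < R"
    show "time_integral h x y \<le> ennreal D * green \<nu> \<beta> x y"
    proof (cases "x = y")
      case True
      then show ?thesis
        using D by (simp add: green_eq_profile ennreal_mult_top)
    next
      case False
      define d where "d = dist x y"
      have d: "0 < d" "d < R"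
        using xy False by (auto simp: d_def)
      let ?g = "green_profile \<nu> \<beta> d"
      have "time_integral h x y \<le>
          (\<integral>\<^sup>+s. ennreal (A * d powr (- \<nu>)) * indicator {0..d powr \<beta>} s
            + ennreal A * (ennreal (s powr (- (\<nu> / \<beta>))) * indicator {d powr \<beta>..\<tau>} s)
            + ennreal K * (ennreal (exp (- \<alpha> * s)) * indicator {0..} s) \<partial>lborel)"
        unfolding time_integral_def
      proof (rule nn_integral_mono)
        fix s :: real
        let ?u = "ennreal (A * d powr (- \<nu>)) * indicator {0..d powr \<beta>} s"
        let ?v = "ennreal A * (ennreal (s powr (- (\<nu> / \<beta>))) * indicator {d powr \<beta>..\<tau>} s)"
        let ?w = "ennreal K * (ennreal (exp (- \<alpha> * s)) * indicator {0..} s)"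
        consider "s \<le> 0" | "0 < s" "s \<le> d powr \<beta>" | "0 < s" "d powr \<beta> \<le> s" "s \<le> \<tau>" | "0 < s" "\<tau> < s"
          by linarith
        then have "ennreal (h s x y) * indicator {0<..} s \<le> max ?u (max ?v ?w)"
        proof cases
          case 2
          have "h s x y \<le> A * d powr (- \<nu>)"
            using off[of x y s] small[OF d] 2 False by (auto simp: d_def)
          then have "ennreal (h s x y) * indicator {0<..} s \<le> ?u"
            using 2 by (auto intro: ennreal_leI)
          then show ?thesis by (rule max.coboundedI1)
        next
          case 3
          have "h s x y \<le> A * s powr (- (\<nu> / \<beta>))"
            using 3 by (intro on)
          then have "ennreal (h s x y) * indicator {0<..} s \<le> ?v"
            using 3 \<open>A > 0\<close> by (auto simp flip: ennreal_mult' intro: ennreal_leI)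
          then show ?thesis by (intro max.coboundedI2[OF max.coboundedI1])
        next
          case 4
          have "h s x y \<le> K * exp (- \<alpha> * s)"
            using 4 by (intro late)
          then have "ennreal (h s x y) * indicator {0<..} s \<le> ?w"
            using 4 \<open>K \<ge> 0\<close> by (auto simp flip: ennreal_mult' intro: ennreal_leI)
          then show ?thesis by (intro max.coboundedI2)
        qed auto
        \<comment> \<open>The maximum over the pieces gives way to the sum, whose integral splits.\<close>
        also have "max ?u (max ?v ?w) \<le> ?u + ?v + ?w"
          by (intro max.boundedI) (auto simp: add_increasing add_increasing2)
        finally show "ennreal (h s x y) * indicator {0<..} s \<le> ?u + ?v + ?w" .
      qed
      also have "\<dots> = ennreal (A * d powr (- \<nu>)) * ennreal (d powr \<beta>)
            + ennreal A * (\<integral>\<^sup>+s\<in>{d powr \<beta>..\<tau>}. ennreal (s powr (- (\<nu> / \<beta>))) \<partial>lborel)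
            + ennreal K * ennreal (1 / \<alpha>)"
        unfolding exp_int[symmetric]
        by (simp add: nn_integral_add nn_integral_cmult nn_integral_cmult_indicator)
      also have "\<dots> \<le> ennreal (A * ?g) + ennreal A * ennreal (C * ?g) + ennreal (K / \<alpha> * ?g)"
      proof (intro add_mono mult_left_mono up[OF d])
        have "A * d powr (- \<nu>) * d powr \<beta> = A * d powr (\<beta> - \<nu>)"
          by (simp add: mult.assoc flip: powr_add)
        then show "ennreal (A * d powr (- \<nu>)) * ennreal (d powr \<beta>) \<le> ennreal (A * ?g)"
          using pow[OF d] \<open>A > 0\<close> by (auto simp flip: ennreal_mult' intro!: ennreal_leI)
        have "K / \<alpha> * 1 \<le> K / \<alpha> * ?g"
          using one[OF d] \<open>\<alpha> > 0\<close> \<open>K \<ge> 0\<close> by (intro mult_left_mono) auto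
        then show "ennreal K * ennreal (1 / \<alpha>) \<le> ennreal (K / \<alpha> * ?g)"
          using \<open>\<alpha> > 0\<close> \<open>K \<ge> 0\<close> by (auto simp flip: ennreal_mult' intro!: ennreal_leI)
      qed simp
      also have "\<dots> = ennreal (D * ?g)"
        using one[OF d] \<open>\<alpha> > 0\<close> \<open>K \<ge> 0\<close> \<open>A > 0\<close> C
        by (simp add: D_def algebra_simps flip: ennreal_mult' ennreal_plus)
      also have "\<dots> = ennreal D * green \<nu> \<beta> x y"
        using False D by (simp add: green_eq_profile d_def ennreal_mult')
      finally show ?thesis .
    qed
  qed (use D C in auto)
qed

section \<open>Consequences of the heat kernel estimates\<close>

text \<open>
  As \<open>\<Phi>\<close> is decreasing, the integral over \<open>[1, u]\<close> is at least \<open>\<Phi> u\<close> times the integral of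
  \<open>t\<^sup>\<nu>\<^sup>-\<^sup>1\<close>, that is \<open>\<Phi> u * (u\<^sup>\<nu> - 1) / \<nu>\<close>; the term with \<open>- 1\<close> is bounded by \<open>\<Phi> 0 / \<nu>\<close>.
  This trades the integrability hypothesis for a pointwise bound, which spares a change of variables
  in the time integral.
\<close>

lemma antimono_power_decay:
  fixes \<Phi> :: "real \<Rightarrow> real"
  assumes "\<nu> > 0" and pos: "\<And>s. s \<ge> 0 \<Longrightarrow> \<Phi> s > 0" and anti: "antimono_on {0..} \<Phi>"
    and int: "(\<integral>\<^sup>+t\<in>{1..}. ennreal (t powr \<nu> * \<Phi> t / t) \<partial>lborel) < \<infinity>"
  obtains A where "A > 0" "\<And>u. u \<ge> 0 \<Longrightarrow> \<Phi> u \<le> A"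
    and "\<And>u. u \<ge> 1 \<Longrightarrow> \<Phi> u \<le> A * u powr (- \<nu>)"
proof -
  obtain I where I: "I \<ge> 0" "(\<integral>\<^sup>+t\<in>{1..}. ennreal (t powr \<nu> * \<Phi> t / t) \<partial>lborel) = ennreal I"
    using int by (cases "\<integral>\<^sup>+t\<in>{1..}. ennreal (t powr \<nu> * \<Phi> t / t) \<partial>lborel") auto
  have dec: "\<Phi> v \<le> \<Phi> u" if "0 \<le> u" "u \<le> v" for u v
    using anti that by (auto simp: monotone_on_def)
  show thesis
  proof (rule that[of "\<nu> * I + \<Phi> 0"])
    show "\<nu> * I + \<Phi> 0 > 0"
      using I assms(1) pos[of 0] by (simp add: add_nonneg_pos)
    show "\<Phi> u \<le> \<nu> * I + \<Phi> 0" if "u \<ge> 0" for u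
      using dec[of 0 u] that I assms(1) by (simp add: add_increasing)
    show "\<Phi> u \<le> (\<nu> * I + \<Phi> 0) * u powr (- \<nu>)" if u: "u \<ge> 1" for u
    proof -
      have "ennreal (\<Phi> u * (u powr \<nu> / \<nu> - 1 / \<nu>))
          = (\<integral>\<^sup>+t\<in>{1..u}. ennreal (\<Phi> u * t powr (\<nu> - 1)) \<partial>lborel)"
      proof -
        have "(\<integral>\<^sup>+t\<in>{1..u}. ennreal (\<Phi> u * t powr (\<nu> - 1)) \<partial>lborel)
            = ennreal (\<Phi> u * (u powr \<nu> / \<nu>) - \<Phi> u * (1 powr \<nu> / \<nu>))"
          using u assms(1) pos[of u]
          by (intro nn_integral_FTC_Icc) (auto intro!: derivative_eq_intros)
        then show ?thesis by (simp add: right_diff_distrib)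
      qed
      also have "\<dots> \<le> (\<integral>\<^sup>+t\<in>{1..}. ennreal (t powr \<nu> * \<Phi> t / t) \<partial>lborel)"
      proof (rule nn_integral_mono)
        fix t :: real
        have "\<Phi> u * t powr (\<nu> - 1) \<le> t powr \<nu> * \<Phi> t / t" if "1 \<le> t" "t \<le> u"
          using that dec[of t u] by (simp add: powr_diff divide_right_mono mult.commute)
        then show "ennreal (\<Phi> u * t powr (\<nu> - 1)) * indicator {1..u} t
            \<le> ennreal (t powr \<nu> * \<Phi> t / t) * indicator {1..} t"
          by (auto simp: indicator_def intro: ennreal_leI)
      qed
      also have "\<dots> = ennreal I"
        by (fact I(2))
      finally have "\<Phi> u * (u powr \<nu> / \<nu> - 1 / \<nu>) \<le> I"
        using I(1) by (simp add: ennreal_le_iff)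
      then have "\<Phi> u * u powr \<nu> \<le> \<nu> * I + \<Phi> u"
        using assms(1) by (simp add: field_simps)
      also have "\<dots> \<le> \<nu> * I + \<Phi> 0"
        using dec[of 0 u] u by simp
      finally show ?thesis
        using u by (simp add: powr_minus field_simps)
    qed
  qed
qed

text \<open>
  By the Chapman-Kolmogorov equation the kernel at time \<open>s\<close> is an average, of total mass at most 1,
  of the kernel at time \<open>\<tau>\<close>. This covers the times beyond the range of the heat kernel estimates.
\<close>

lemma heat_kernel_le_of_bound_at_time:
  assumes "heat_kernel m X P pk" "sets m = sets borel" "0 < \<tau>" "\<tau> < s"
    and bound: "\<And>x y. pk \<tau> x y \<le> K"
  shows "pk s x y \<le> K"
proof -
  interpret heat_kernel m X P pk by fact
  note [measurable_cong] = assms(2)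
  have K: "K \<ge> 0"
    using kernel_nonneg[OF assms(3)] bound by (meson order_trans)
  have "(\<lambda>z. (s - \<tau>, x, z)) \<in> measurable borel (restrict_space borel {0<..} \<Otimes>\<^sub>M borel \<Otimes>\<^sub>M borel)"
    using assms(4) by (intro measurable_Pair measurable_const) (auto simp: space_restrict_space)
  from measurable_compose[OF this kernel_measurable]
  have [measurable]: "(\<lambda>z. pk (s - \<tau>) x z) \<in> borel_measurable borel"
    by simp
  have "ennreal (pk s x y) = ennreal (pk (\<tau> + (s - \<tau>)) x y)"
    by simp
  also have "\<dots> = (\<integral>\<^sup>+z. ennreal (pk (s - \<tau>) x z * pk \<tau> z y) \<partial>m)"
    using assms by (intro chapman_kolmogorov) auto
  also have "\<dots> \<le> (\<integral>\<^sup>+z. ennreal K * ennreal (pk (s - \<tau>) x z) \<partial>m)"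
    using kernel_nonneg[of "s - \<tau>"] bound K assms(4)
    by (intro nn_integral_mono)
       (auto simp: mult.commute[of K] simp flip: ennreal_mult' intro!: ennreal_leI mult_left_mono)
  also have "\<dots> = ennreal K * (\<integral>\<^sup>+z. ennreal (pk (s - \<tau>) x z) \<partial>m)"
    by (rule nn_integral_cmult) measurable
  also have "\<dots> \<le> ennreal K * 1"
    using assms(4) by (intro mult_left_mono kernel_mass) auto
  finally show ?thesis
    using K by (simp add: ennreal_le_iff)
qed

text \<open>
  The weight is bounded below where the lower bound is obtained, and changes the constants in
  the upper bounds by the factor \<open>B\<close>; its exponential decay makes the contribution of long times
  finite.
\<close>

lemma weighted_time_integral_comparable_green:
  fixes pk :: "real \<Rightarrow> 'a::metric_space \<Rightarrow> 'a \<Rightarrow> real"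
  assumes "\<beta> > 0" "\<nu> \<ge> \<beta>" "\<tau> > 0" "\<alpha> > 0" "A > 0" "K \<ge> 0" "a > 0" "b > 0" "B > 0"
    and lower: "\<And>s x y. 0 < s \<Longrightarrow> s \<le> \<tau> \<Longrightarrow> dist x y powr \<beta> \<le> s \<Longrightarrow>
          a * s powr (- (\<nu> / \<beta>)) \<le> pk s x y"
    and off: "\<And>s x y. x \<noteq> y \<Longrightarrow> 0 < s \<Longrightarrow> s \<le> \<tau> \<Longrightarrow> s \<le> dist x y powr \<beta> \<Longrightarrow>
          pk s x y \<le> A * dist x y powr (- \<nu>)"
    and on: "\<And>s x y. 0 < s \<Longrightarrow> s \<le> \<tau> \<Longrightarrow> pk s x y \<le> A * s powr (- (\<nu> / \<beta>))"
    and late: "\<And>s x y. \<tau> < s \<Longrightarrow> pk s x y \<le> K"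
    and w_lower: "\<And>s. 0 < s \<Longrightarrow> s \<le> \<tau> \<Longrightarrow> b \<le> w s"
    and w_nonneg: "\<And>s. 0 < s \<Longrightarrow> 0 \<le> w s"
    and w_upper: "\<And>s. 0 < s \<Longrightarrow> w s \<le> B * exp (- \<alpha> * s)"
  shows "comparable_near_diagonal (time_integral (\<lambda>s x y. w s * pk s x y)) (green \<nu> \<beta>)"
proof -
  let ?h = "\<lambda>s x y. w s * pk s x y"
  have weight: "?h s x y \<le> B * q" if "0 < s" "pk s x y \<le> q" "0 \<le> q" for s x y q
  proof -
    have "w s \<le> B * exp (- \<alpha> * s)"
      using that(1) by (rule w_upper)
    also have "\<dots> \<le> B * 1"
      using that(1) \<open>\<alpha> > 0\<close> \<open>B > 0\<close> by (intro mult_left_mono) auto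
    finally have "w s \<le> B" by simp
    have "w s * pk s x y \<le> w s * q"
      using that w_nonneg by (intro mult_left_mono) auto
    also have "\<dots> \<le> B * q"
      using that \<open>w s \<le> B\<close> by (intro mult_right_mono)
    finally show ?thesis .
  qed
  obtain c R where c: "c > 0" "R > 0"
    and lo: "\<And>x y. dist x y < R \<Longrightarrow> ennreal c * green \<nu> \<beta> x y \<le> time_integral ?h x y"
  proof (rule green_le_time_integral[of \<beta> \<nu> \<tau> "b * a" ?h])
    fix s :: real and x y :: 'a
    assume s: "0 < s" "s \<le> \<tau>" "dist x y powr \<beta> \<le> s"
    have "b * (a * s powr (- (\<nu> / \<beta>))) \<le> w s * pk s x y"
      using lower[OF s] w_lower[OF s(1,2)] w_nonneg[OF s(1)] \<open>a > 0\<close>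
      by (intro mult_mono) auto
    then show "b * a * s powr (- (\<nu> / \<beta>)) \<le> w s * pk s x y"
      by (simp add: mult.assoc)
  qed (use assms in auto)
  obtain C R' where C: "C > 0" "R' > 0"
    and up: "\<And>x y. dist x y < R' \<Longrightarrow> time_integral ?h x y \<le> ennreal C * green \<nu> \<beta> x y"
  proof (rule time_integral_le_green[of \<beta> \<nu> \<tau> \<alpha> "B * A" "B * K" ?h])
    fix s :: real and x y :: 'a
    show "?h s x y \<le> B * A * dist x y powr (- \<nu>)"
      if "x \<noteq> y" "0 < s" "s \<le> \<tau>" "s \<le> dist x y powr \<beta>"
      using weight[OF that(2) off[OF that]] \<open>A > 0\<close> by (simp add: mult.assoc)
    show "?h s x y \<le> B * A * s powr (- (\<nu> / \<beta>))" if "0 < s" "s \<le> \<tau>"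
      using weight[OF that(1) on[OF that]] \<open>A > 0\<close> by (simp add: mult.assoc)
    show "?h s x y \<le> B * K * exp (- \<alpha> * s)" if "\<tau> < s"
    proof -
      have "0 < s" using that \<open>\<tau> > 0\<close> by simp
      then have "w s * pk s x y \<le> w s * K"
        using w_nonneg late[OF that] by (intro mult_left_mono) auto
      also have "\<dots> \<le> B * exp (- \<alpha> * s) * K"
        using w_upper[OF \<open>0 < s\<close>] \<open>K \<ge> 0\<close> by (rule mult_right_mono)
      finally show ?thesis by (simp add: mult_ac)
    qed
  qed (use assms in auto)
  show ?thesis
    unfolding comparable_near_diagonal_def
    using c C lo up by (intro exI[of _ c] exI[of _ C] exI[of _ "min R R'"] conjI) auto
qed

text \<open>
  The estimates are used up to a time \<open>\<tau>\<close> below both the range \<open>t\<^sub>0\<close> of their validity and the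
  range \<open>\<epsilon>\<close> on which the weight is bounded below; from there on the Chapman-Kolmogorov equation
  takes over. The shape of \<open>\<Phi>\<^sub>1\<close> enters through \<open>\<Phi>\<^sub>1 1\<close>
  alone, since its argument is at most 1 when \<open>dist x y powr \<beta> \<le> s\<close>.
\<close>

lemma weighted_heat_kernel_comparable_green:
  fixes m :: "'a::metric_space measure"
  assumes kernel: "heat_kernel m X P pk" and m: "sets m = sets borel"
    and est: "heat_kernel_estimates pk \<nu> \<beta> t\<^sub>0 V"
    and params: "\<beta> > 0" "\<nu> \<ge> \<beta>" "t\<^sub>0 > 0"
    and w: "\<alpha> > 0" "b > 0" "B > 0" "\<epsilon> > 0"
    and w_lower: "\<And>s. 0 < s \<Longrightarrow> s < \<epsilon> \<Longrightarrow> b \<le> w s"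
    and w_nonneg: "\<And>s. 0 < s \<Longrightarrow> 0 \<le> w s"
    and w_upper: "\<And>s. 0 < s \<Longrightarrow> w s \<le> B * exp (- \<alpha> * s)"
  shows "comparable_near_diagonal (time_integral (\<lambda>s x y. w s * pk s x y)) (green \<nu> \<beta>)"
proof -
  obtain \<Phi>\<^sub>1 \<Phi>\<^sub>2 :: "real \<Rightarrow> real" where pos: "\<forall>s\<ge>0. \<Phi>\<^sub>1 s > 0 \<and> \<Phi>\<^sub>2 s > 0"
    and anti: "antimono_on {0..} \<Phi>\<^sub>1" "antimono_on {0..} \<Phi>\<^sub>2"
    and tail: "(\<integral>\<^sup>+t\<in>{1..}. ennreal (max (V t) (t powr \<nu>) * \<Phi>\<^sub>2 t / t) \<partial>lborel) < \<infinity>"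
    and bounds: "\<forall>x y t. 0 < t \<and> ereal t < t\<^sub>0 \<longrightarrow>
           1 / t powr (\<nu> / \<beta>) * \<Phi>\<^sub>1 (dist x y / t powr (1 / \<beta>)) \<le> pk t x y \<and>
           pk t x y \<le> 1 / t powr (\<nu> / \<beta>) * \<Phi>\<^sub>2 (dist x y / t powr (1 / \<beta>))"
    using est unfolding heat_kernel_estimates_def by (elim exE conjE) (rule that)
  have "(\<integral>\<^sup>+t\<in>{1..}. ennreal (t powr \<nu> * \<Phi>\<^sub>2 t / t) \<partial>lborel)
      \<le> (\<integral>\<^sup>+t\<in>{1..}. ennreal (max (V t) (t powr \<nu>) * \<Phi>\<^sub>2 t / t) \<partial>lborel)"
    using pos by (intro nn_integral_mono)
      (auto simp: indicator_def less_imp_le intro!: ennreal_leI divide_right_mono mult_right_mono)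
  with tail have tail': "(\<integral>\<^sup>+t\<in>{1..}. ennreal (t powr \<nu> * \<Phi>\<^sub>2 t / t) \<partial>lborel) < \<infinity>"
    by (rule le_less_trans[rotated])
  have \<nu>: "\<nu> > 0"
    using params by simp
  have pos2: "\<Phi>\<^sub>2 u > 0" if "u \<ge> 0" for u
    using pos that by blast
  obtain A where A: "A > 0" "\<And>u. u \<ge> 0 \<Longrightarrow> \<Phi>\<^sub>2 u \<le> A"
    and decay: "\<And>u. u \<ge> 1 \<Longrightarrow> \<Phi>\<^sub>2 u \<le> A * u powr (- \<nu>)"
    by (rule antimono_power_decay[OF \<nu> pos2 anti(2) tail']) (assumption, rule that)
  obtain \<tau> where \<tau>: "0 < \<tau>" "\<tau> < \<epsilon>" "ereal \<tau> < t\<^sub>0"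
  proof -
    have "0 < min t\<^sub>0 (ereal \<epsilon>)"
      using params w by simp
    then obtain \<tau> where "0 < ereal \<tau>" "ereal \<tau> < min t\<^sub>0 (ereal \<epsilon>)"
      by (blast dest: ereal_dense2)
    then show thesis
      by (intro that) auto
  qed
  have est_lo: "1 / s powr (\<nu> / \<beta>) * \<Phi>\<^sub>1 (dist x y / s powr (1 / \<beta>)) \<le> pk s x y"
    and est_up: "pk s x y \<le> 1 / s powr (\<nu> / \<beta>) * \<Phi>\<^sub>2 (dist x y / s powr (1 / \<beta>))"
    if "0 < s" "s \<le> \<tau>" for s x y
  proof -
    have "ereal s \<le> ereal \<tau>"
      using that(2) by simp
    then have "ereal s < t\<^sub>0"
      using \<tau>(3) by (rule le_less_trans)
    with bounds that(1)
    show "1 / s powr (\<nu> / \<beta>) * \<Phi>\<^sub>1 (dist x y / s powr (1 / \<beta>)) \<le> pk s x y"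
      "pk s x y \<le> 1 / s powr (\<nu> / \<beta>) * \<Phi>\<^sub>2 (dist x y / s powr (1 / \<beta>))"
      by blast+
  qed
  have on: "pk s x y \<le> A * s powr (- (\<nu> / \<beta>))" if "0 < s" "s \<le> \<tau>" for s x y
  proof -
    have "1 / s powr (\<nu> / \<beta>) * \<Phi>\<^sub>2 (dist x y / s powr (1 / \<beta>)) \<le> 1 / s powr (\<nu> / \<beta>) * A"
      by (intro mult_left_mono A(2)) auto
    with est_up[OF that, of x y] show ?thesis
      by (simp add: powr_minus divide_inverse mult.commute)
  qed
  show ?thesis
  proof (rule weighted_time_integral_comparable_green[of \<beta> \<nu> \<tau> \<alpha> A
        "A * \<tau> powr (- (\<nu> / \<beta>))" "\<Phi>\<^sub>1 1" b B pk w])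
    fix s :: real and x y :: 'a
    show "\<Phi>\<^sub>1 1 * s powr (- (\<nu> / \<beta>)) \<le> pk s x y"
      if s: "0 < s" "s \<le> \<tau>" "dist x y powr \<beta> \<le> s"
    proof -
      have "(dist x y powr \<beta>) powr (1 / \<beta>) \<le> s powr (1 / \<beta>)"
        using s params by (intro powr_mono2) auto
      then have "dist x y \<le> s powr (1 / \<beta>)"
        using params by (simp add: powr_powr)
      then have "\<Phi>\<^sub>1 1 \<le> \<Phi>\<^sub>1 (dist x y / s powr (1 / \<beta>))"
        using s by (intro monotone_onD[OF anti(1)]) auto
      then have "1 / s powr (\<nu> / \<beta>) * \<Phi>\<^sub>1 1 \<le> 1 / s powr (\<nu> / \<beta>) * \<Phi>\<^sub>1 (dist x y / s powr (1 / \<beta>))"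
        by (rule mult_left_mono) simp
      with est_lo[OF s(1,2), of x y] show ?thesis
        by (simp add: powr_minus divide_inverse mult.commute)
    qed
    show "pk s x y \<le> A * dist x y powr (- \<nu>)"
      if s: "x \<noteq> y" "0 < s" "s \<le> \<tau>" "s \<le> dist x y powr \<beta>"
    proof -
      have "s powr (1 / \<beta>) \<le> (dist x y powr \<beta>) powr (1 / \<beta>)"
        using s params by (intro powr_mono2) auto
      then have "s powr (1 / \<beta>) \<le> dist x y"
        using params s by (simp add: powr_powr)
      then have "\<Phi>\<^sub>2 (dist x y / s powr (1 / \<beta>)) \<le> A * (dist x y / s powr (1 / \<beta>)) powr (- \<nu>)"
        using s by (intro decay) auto
      also have "\<dots> = A * dist x y powr (- \<nu>) * s powr (\<nu> / \<beta>)"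
        using s by (simp add: powr_divide powr_powr powr_minus field_simps)
      finally have "1 / s powr (\<nu> / \<beta>) * \<Phi>\<^sub>2 (dist x y / s powr (1 / \<beta>))
          \<le> 1 / s powr (\<nu> / \<beta>) * (A * dist x y powr (- \<nu>) * s powr (\<nu> / \<beta>))"
        by (rule mult_left_mono) simp
      with est_up[OF s(2,3), of x y] s(2) show ?thesis
        by simp
    qed
    show "pk s x y \<le> A * \<tau> powr (- (\<nu> / \<beta>))" if "\<tau> < s"
      using heat_kernel_le_of_bound_at_time[OF kernel m \<tau>(1) that] on[OF \<tau>(1)] by simp
  qed (use params w w_lower w_nonneg w_upper \<tau> on A(1) pos in auto)
qed

section \<open>Characterisation of the Kato and Dynkin classes\<close>

theorem theorem4p1:
  fixes m \<mu> :: "'a::{metric_space, second_countable_topology} measure"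
    and \<F> :: "('a \<Rightarrow> real) set"
    and \<E> :: "('a \<Rightarrow> real) \<Rightarrow> ('a \<Rightarrow> real) \<Rightarrow> real"
    and M :: "'w measure"
    and X :: "ennreal \<Rightarrow> 'w \<Rightarrow> 'a option"
    and P :: "'a option \<Rightarrow> 'w measure"
    and pk :: "real \<Rightarrow> 'a \<Rightarrow> 'a \<Rightarrow> real"
    and p \<nu> \<beta> :: real
    and t\<^sub>0 :: ereal
    and V :: "real \<Rightarrow> real"
  assumes loc_compact: "locally_compact_space (euclidean :: 'a topology)"
    and radon_asm: "radon_measure m" and support: "full_support m"
    and form_asm: "regular_dirichlet_form m \<F> \<E>"
    and hunt_asm: "hunt_process M X P"
    and assoc: "associated_process m \<F> \<E> X P"
    and kernel: "heat_kernel m X P pk"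
    and p_asm: "p \<ge> 1" and "\<nu> > 0" and "\<beta> > 0" and "\<nu> \<ge> \<beta>"
    and t0_asm: "t\<^sub>0 > 0"
    and "\<forall>r>0. V r > 0" and "mono_on {0<..} V"
    and estimates: "heat_kernel_estimates pk \<nu> \<beta> t\<^sub>0 V"
    and borel_\<mu>: "sets \<mu> = sets borel"
  shows
    "(\<mu> \<in> kato_class \<nu> \<beta> p \<longleftrightarrow>
        (\<forall>\<alpha>>0. (ball_sup \<mu> p (resolvent_kernel pk \<alpha>) \<longlongrightarrow> 0) (at_right 0))) \<and>
     (\<mu> \<in> kato_class \<nu> \<beta> p \<longleftrightarrow>
        (\<exists>\<alpha>>0. (ball_sup \<mu> p (resolvent_kernel pk \<alpha>) \<longlongrightarrow> 0) (at_right 0))) \<and>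
     (\<mu> \<in> kato_class \<nu> \<beta> p \<longleftrightarrow>
        (\<forall>t>0. (ball_sup \<mu> p (truncated_green pk t) \<longlongrightarrow> 0) (at_right 0))) \<and>
     (\<mu> \<in> kato_class \<nu> \<beta> p \<longleftrightarrow>
        (\<exists>t>0. (ball_sup \<mu> p (truncated_green pk t) \<longlongrightarrow> 0) (at_right 0))) \<and>
     (\<mu> \<in> dynkin_class \<nu> \<beta> p \<longleftrightarrow>
        (\<forall>\<alpha>>0. \<exists>r>0. ball_sup \<mu> p (resolvent_kernel pk \<alpha>) r < \<infinity>)) \<and>
     (\<mu> \<in> dynkin_class \<nu> \<beta> p \<longleftrightarrow>
        (\<exists>\<alpha>>0. \<exists>r>0. ball_sup \<mu> p (resolvent_kernel pk \<alpha>) r < \<infinity>)) \<and>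
     (\<mu> \<in> dynkin_class \<nu> \<beta> p \<longleftrightarrow>
        (\<forall>t>0. \<exists>r>0. ball_sup \<mu> p (truncated_green pk t) r < \<infinity>)) \<and>
     (\<mu> \<in> dynkin_class \<nu> \<beta> p \<longleftrightarrow>
        (\<exists>t>0. \<exists>r>0. ball_sup \<mu> p (truncated_green pk t) r < \<infinity>))"
proof -
  have m: "sets m = sets borel"
    using radon_asm by (simp add: radon_measure_def)
  note comparable = weighted_heat_kernel_comparable_green[OF kernel m estimates \<open>\<beta> > 0\<close> \<open>\<nu> \<ge> \<beta>\<close> t0_asm]
  have resolvent: "comparable_near_diagonal (resolvent_kernel pk \<alpha>) (green \<nu> \<beta>)" if "\<alpha> > 0" for \<alpha>
  proof -
    have "resolvent_kernel pk \<alpha> = time_integral (\<lambda>s x y. exp (- \<alpha> * s) * pk s x y)"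
      by (intro ext) (simp add: resolvent_kernel_def time_integral_def)
    moreover have "comparable_near_diagonal \<dots> (green \<nu> \<beta>)"
      using that by (intro comparable[of \<alpha> "exp (- \<alpha>)" 1 1]) auto
    ultimately show ?thesis by simp
  qed
  have truncated: "comparable_near_diagonal (truncated_green pk t) (green \<nu> \<beta>)" if "t > 0" for t
  proof -
    have "truncated_green pk t = time_integral (\<lambda>s x y. indicator {..<t} s * pk s x y)"
      unfolding truncated_green_def time_integral_def
      by (intro ext nn_integral_cong) (auto simp: indicator_def)
    moreover have "comparable_near_diagonal \<dots> (green \<nu> \<beta>)"
      \<comment> \<open>the indicator of \<open>s < t\<close> is at most \<open>exp t * exp (- s)\<close>\<close>
      using that by (intro comparable[of 1 1 "exp t" t]) (auto simp: indicator_def simp flip: exp_add)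
    ultimately show ?thesis by simp
  qed
  have p: "p \<ge> 0" using p_asm by simp
  note kato = kato_class_iff_comparable[OF _ borel_\<mu> p]
  note dynkin = dynkin_class_iff_comparable[OF _ borel_\<mu> p]
  show ?thesis
    using kato[OF resolvent] kato[OF truncated] dynkin[OF resolvent] dynkin[OF truncated]
      zero_less_one[where 'a = real] by (intro conjI) blast+
qed

end
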